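(* Consider the following process on the cycle with $n\ge 3$ nodes $1,\dots,n$ (node $i$ adjacent to $i-1$ and $i+1$, indices modulo $n$). Each node $i$ carries a real load $x_i(t)$, and initially all loads are equal. At each step $t=0,1,2,\dots$, an edge $\{i,i+1\}$ is chosen uniformly at random among the $n$ cycle edges and a weight $w(t)$ is drawn from a fixed real distribution $W$ with $\mathbb{E}[W^2]\le 1$, independently of everything else; then $x_i(t+1)=x_{i+1}(t+1)=\frac{x_i(t)+x_{i+1}(t)+w(t)}{2}$, and all other loads are unchanged. Let $Gap(t)=\max_{1\le i\le n}x_i(t)-\min_{1\le i\le n}x_i(t)$. Then for every $t\ge 0$, \[\mathbb{E}[Gap(t)]=O(\sqrt{n}\log n),\] i.e. there is an absolute constant $C$ (independent of $n$, $t$ and $W$) with $\mathbb{E}[Gap(t)]\le C\sqrt{n}\log n$.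
   Context: The edge choice and the weight are independent across steps and independent of the current loads. *)

theory Defs
  imports "HOL-Probability.Probability"
begin

text \<open>
  The nodes of the cycle are \<open>0, \<dots>, n - 1\<close>, and the edge \<open>{i, i + 1 mod n}\<close> is
  identified with \<open>i\<close>, so the \<open>n\<close> edges are also indexed by \<open>{..<n}\<close>.
\<close>

definition balance :: "nat \<Rightarrow> nat \<Rightarrow> real \<Rightarrow> (nat \<Rightarrow> real) \<Rightarrow> (nat \<Rightarrow> real)" where
  "balance n i w x =
     (let a = (x i + x (Suc i mod n) + w) / 2 in x(i := a, Suc i mod n := a))"

text \<open>
  A sample point \<open>\<omega>\<close> lists, for every step, the chosen edge and the drawn weight;
  \<open>c\<close> is the common initial load.
\<close>

primrec load :: "nat \<Rightarrow> real \<Rightarrow> (nat \<Rightarrow> nat \<times> real) \<Rightarrow> nat \<Rightarrow> (nat \<Rightarrow> real)" where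
  "load n c \<omega> 0 = (\<lambda>_. c)"
| "load n c \<omega> (Suc t) = balance n (fst (\<omega> t)) (snd (\<omega> t)) (load n c \<omega> t)"

definition gap :: "nat \<Rightarrow> real \<Rightarrow> nat \<Rightarrow> (nat \<Rightarrow> nat \<times> real) \<Rightarrow> real" where
  "gap n c t \<omega> = Max (load n c \<omega> t ` {..<n}) - Min (load n c \<omega> t ` {..<n})"

text \<open>
  The product measures make the edge and the weight of a step independent of each other
  and of all other steps, hence of the current loads.
\<close>

definition cycle_process :: "nat \<Rightarrow> real measure \<Rightarrow> (nat \<Rightarrow> nat \<times> real) measure" where
  "cycle_process n W =
     (\<Pi>\<^sub>M t\<in>UNIV. measure_pmf (pmf_of_set {..<n}) \<Otimes>\<^sub>M W)"

end

theory Submission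
  imports Defs
begin

text \<open>
  For a load vector \<open>x\<close> let \<open>hop n x k\<close> be the sum of \<open>(x\<^sub>i\<^sub>+\<^sub>k - x\<^sub>i)\<^sup>2\<close> over the cycle.
  Averaging over the edge, the hop sums follow an affine recursion \<open>d \<mapsto> L d + w\<^sup>2 b\<close> from which
  the mean of the weight drops out. The map \<open>L\<close> is not monotone, but it preserves the convex cone
  generated by hop sums of load vectors, all of which are nonnegative. The hop sums of the sawtooth
  \<open>i \<mapsto> i\<close>, divided by \<open>n\<close>, are \<open>T = k (n - k)\<close> and satisfy \<open>T = L T + b + g\<close> with \<open>g\<close> in the cone.
  If \<open>\<sigma>\<^sup>2\<close> is the second moment of the weight, \<open>\<sigma>\<^sup>2 T\<close> minus the expected hop sums therefore stays in
  the cone forever, so the latter never exceed \<open>\<sigma>\<^sup>2 k (n - k)\<close>. Comparing means over dyadic windows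
  bounds the gap by \<open>\<Sum>\<^sub>j sqrt (hop n x (2\<^sup>j) / 2\<^sup>j)\<close>, whose \<open>O(log n)\<close> terms have expectation at most
  \<open>sqrt n\<close> each when \<open>\<sigma>\<^sup>2 \<le> 1\<close>.
\<close>

subsection \<open>Hop sums\<close>

lemma sum_mod_shift:
  fixes f :: "nat \<Rightarrow> 'a::comm_monoid_add"
  shows "(\<Sum>i<n. f ((i + a) mod n)) = (\<Sum>i<n. f i)"
proof (induction a)
  case (Suc a)
  have "(\<Sum>i<n. f ((i + Suc a) mod n)) = (\<Sum>i<n. f ((i + a) mod n))"
  proof (cases n)
    case (Suc m)
    then have "f ((m + Suc a) mod n) = f ((0 + a) mod n)"
      using mod_add_self1[of n a] by simp
    then have "(\<Sum>i<Suc m. f ((i + Suc a) mod n)) = f ((0 + a) mod n)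
        + (\<Sum>i<m. f ((Suc i + a) mod n))"
      by (simp add: add.commute)
    also have "\<dots> = (\<Sum>i<Suc m. f ((i + a) mod n))"
      by (rule sum.lessThan_Suc_shift[symmetric])
    finally show ?thesis unfolding Suc .
  qed simp
  then show ?case using Suc by simp
qed simp

text \<open>
  At \<open>k = n\<close> the sum vanishes anyway; cutting it off beyond makes the averaged recursion below
  hold for every \<open>k\<close>.
\<close>

definition hop :: "nat \<Rightarrow> (nat \<Rightarrow> real) \<Rightarrow> nat \<Rightarrow> real" where
  "hop n x k = (if k < n then \<Sum>i<n. (x ((i + k) mod n) - x i)\<^sup>2 else 0)"

lemma hop_nonneg: "0 \<le> hop n x k"
  by (simp add: hop_def sum_nonneg)

lemma sum_square_diff_eq_hop:
  assumes "k \<le> n"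
  shows "(\<Sum>i<n. (x ((i + a + k) mod n) - x ((i + a) mod n))\<^sup>2) = hop n x k"
proof -
  have "(\<Sum>i<n. (x ((i + a + k) mod n) - x ((i + a) mod n))\<^sup>2)
      = (\<Sum>i<n. (x (((i + a) mod n + k) mod n) - x ((i + a) mod n))\<^sup>2)"
    by (simp add: mod_add_left_eq)
  also have "\<dots> = (\<Sum>i<n. (x ((i + k) mod n) - x i)\<^sup>2)"
    by (rule sum_mod_shift[where f = "\<lambda>i. (x ((i + k) mod n) - x i)\<^sup>2"])
  finally show ?thesis using assms by (cases "k = n") (auto simp: hop_def)
qed

lemma hop_reflect:
  assumes "k \<le> n"
  shows "hop n x (n - k) = hop n x k"
proof -
  have "hop n x (n - k) = (\<Sum>i<n. (x ((i + k + (n - k)) mod n) - x ((i + k) mod n))\<^sup>2)"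
    by (rule sum_square_diff_eq_hop[symmetric]) simp
  also have "\<dots> = (\<Sum>i<n. (x ((i + 0 + k) mod n) - x ((i + 0) mod n))\<^sup>2)"
    using assms by (simp add: add.assoc power2_commute)
  also have "\<dots> = hop n x k"
    by (rule sum_square_diff_eq_hop[OF assms])
  finally show ?thesis .
qed

lemma sum_mult_increments:
  assumes "0 < k" "k < n"
  shows "(\<Sum>i<n. (x ((i + 1) mod n) - x i) * (x ((i + k + 1) mod n) - x ((i + k) mod n)))
    = (hop n x (k + 1) + hop n x (k - 1) - 2 * hop n x k) / 2"
proof -
  define X where "X i = x (i mod n)" for i
  have sum_X: "(\<Sum>i<n. (X (i + a + j) - X (i + a))\<^sup>2) = hop n x j" if "j \<le> n" for a j
    unfolding X_def by (rule sum_square_diff_eq_hop[OF that])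
  have "(b - a) * (d - c) = ((d - a)\<^sup>2 + (c - b)\<^sup>2 - (c - a)\<^sup>2 - (d - b)\<^sup>2) / 2" for a b c d :: real
    by (simp add: power2_eq_square field_simps)
  then have "(\<Sum>i<n. (X (i + 1) - X i) * (X (i + k + 1) - X (i + k)))
    = ((\<Sum>i<n. (X (i + k + 1) - X i)\<^sup>2) + (\<Sum>i<n. (X (i + k) - X (i + 1))\<^sup>2)
      - (\<Sum>i<n. (X (i + k) - X i)\<^sup>2) - (\<Sum>i<n. (X (i + k + 1) - X (i + 1))\<^sup>2)) / 2"
    by (simp only: sum.distrib sum_subtractf sum_divide_distrib[symmetric])
  also have "\<dots> = (hop n x (k + 1) + hop n x (k - 1) - hop n x k - hop n x k) / 2"
    using sum_X[of "k + 1" 0] sum_X[of "k - 1" 1] sum_X[of k 0] sum_X[of k 1] assms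
    by (simp add: ac_simps)
  finally show ?thesis by (simp add: X_def)
qed

subsection \<open>Hop sums under one balancing step\<close>

definition second_diff :: "nat \<Rightarrow> nat \<Rightarrow> (nat \<Rightarrow> real) \<Rightarrow> nat \<Rightarrow> real" where
  "second_diff n k x i = x ((i + k) mod n) + x ((i + (n - k)) mod n) - 2 * x i"

lemma hop_fun_upd:
  assumes k: "0 < k" "k < n" and e: "e < n"
  shows "hop n (x(e := x e + p)) k = hop n x k - 2 * p * second_diff n k x e + 2 * p\<^sup>2"
proof -
  define e' where "e' = (e + (n - k)) mod n"
  define y where "y = x(e := x e + p)"
  have e': "e' < n" "e' \<noteq> e" "(e' + k) mod n = e" "(e + k) mod n \<noteq> e"
    using k e by (auto simp: e'_def mod_if)
  have "(\<Sum>i<n. (y ((i + k) mod n) - y i)\<^sup>2 - (x ((i + k) mod n) - x i)\<^sup>2)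
      = (\<Sum>i\<in>{e, e'}. (y ((i + k) mod n) - y i)\<^sup>2 - (x ((i + k) mod n) - x i)\<^sup>2)"
  proof (rule sum.mono_neutral_right)
    show "\<forall>i\<in>{..<n} - {e, e'}. (y ((i + k) mod n) - y i)\<^sup>2 - (x ((i + k) mod n) - x i)\<^sup>2 = 0"
      using k e by (auto simp: y_def e'_def mod_if split: if_splits)
  qed (use e e' in auto)
  also have "\<dots> = - 2 * p * second_diff n k x e + 2 * p\<^sup>2"
    using e' by (simp add: y_def second_diff_def flip: e'_def)
      (simp add: power2_eq_square algebra_simps)
  finally show ?thesis
    using k by (simp add: hop_def sum_subtractf y_def)
qed

text \<open>
  The average over all edges of the hop sums that a single weight \<open>1\<close> produces from zero loads;
  the value \<open>1 / 2\<close> accounts for the edge whose balancing moves both ends of an adjacent pair.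
\<close>

definition hop_noise :: "nat \<Rightarrow> nat \<Rightarrow> real" where
  "hop_noise n k = (if 0 < k \<and> k < n then if k = 1 \<or> k = n - 1 then 1 / 2 else 1 else 0)"

lemma hop_noise_nonneg: "0 \<le> hop_noise n k"
  by (simp add: hop_noise_def)

lemma hop_fun_upd_adjacent:
  fixes n e :: nat
  defines "e' \<equiv> Suc e mod n"
  assumes n: "n \<ge> 3" and k: "0 < k" "k < n" and e: "e < n"
  shows "hop n (x(e := x e + p, e' := x e' + q)) k = hop n x k
    - 2 * (p * second_diff n k x e + q * second_diff n k x e')
    + 2 * (p\<^sup>2 + q\<^sup>2) - 4 * (1 - hop_noise n k) * p * q"
proof -
  define y where "y = x(e := x e + p)"
  have e': "e' < n" "e' \<noteq> e" using n e by (auto simp: e'_def mod_if)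
  have "(e' + k) mod n = e \<longleftrightarrow> k = n - 1" "(e' + (n - k)) mod n = e \<longleftrightarrow> k = 1"
    using n k e by (auto simp: e'_def mod_if)
  moreover have "y i = x i + (if i = e then p else 0)" for i
    by (simp add: y_def)
  ultimately have second_diff_shift: "second_diff n k y e' = second_diff n k x e' + 2 * (1 - hop_noise n k) * p"
    using n k e' by (simp only: second_diff_def) (auto simp: hop_noise_def)
  have "hop n (y(e' := y e' + q)) k = hop n y k - 2 * q * second_diff n k y e' + 2 * q\<^sup>2"
    by (rule hop_fun_upd[OF k e'(1)])
  also have "hop n y k = hop n x k - 2 * p * second_diff n k x e + 2 * p\<^sup>2"
    unfolding y_def by (rule hop_fun_upd[OF k e])
  finally have "hop n (y(e' := y e' + q)) k = hop n x k
      - 2 * p * second_diff n k x e + 2 * p\<^sup>2 - 2 * q * second_diff n k y e' + 2 * q\<^sup>2" .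
  moreover have "x(e := x e + p, e' := x e' + q) = y(e' := y e' + q)"
    using e' by (simp add: y_def)
  ultimately show ?thesis
    unfolding second_diff_shift by (simp add: algebra_simps)
qed

lemma hop_balance:
  fixes n e :: nat
  defines "e' \<equiv> Suc e mod n"
  assumes n: "n \<ge> 3" and k: "0 < k" "k < n" and e: "e < n"
  shows "hop n (balance n e w x) k = hop n x k
    + (x e' - x e) * (second_diff n k x e' - second_diff n k x e)
    - w * (second_diff n k x e + second_diff n k x e')
    + hop_noise n k * w\<^sup>2 + (2 - hop_noise n k) * (x e' - x e)\<^sup>2"
proof -
  define p q where "p = (x e' - x e + w) / 2" and "q = (x e - x e' + w) / 2"
  have "balance n e w x = x(e := x e + p, e' := x e' + q)"
    by (auto simp: balance_def Let_def e'_def p_def q_def field_simps)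
  then show ?thesis
    using hop_fun_upd_adjacent[OF n k e, of x p q, folded e'_def]
    by (simp add: p_def q_def power2_eq_square field_simps)
qed

lemma sum_second_diff: "(\<Sum>i<n. second_diff n k x i) = 0"
  unfolding second_diff_def using sum_mod_shift[of x _ n]
  by (simp add: sum.distrib sum_subtractf flip: sum_distrib_left)

lemma sum_increment_mult_second_diff:
  assumes k: "0 < k" "k < n"
  shows "(\<Sum>e<n. (x (Suc e mod n) - x e) * (second_diff n k x (Suc e mod n) - second_diff n k x e))
    = hop n x (k + 1) + hop n x (k - 1) - 2 * hop n x k - 2 * hop n x 1"
proof -
  define \<delta> where "\<delta> i = x ((i + 1) mod n) - x (i mod n)" for i
  have "(x (Suc e mod n) - x e) * (second_diff n k x (Suc e mod n) - second_diff n k x e)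
      = \<delta> e * \<delta> (e + k) + \<delta> e * \<delta> (e + (n - k)) - 2 * (\<delta> e)\<^sup>2" if "e < n" for e
  proof -
    have "second_diff n k x (Suc e mod n) - second_diff n k x e
        = \<delta> (e + k) + \<delta> (e + (n - k)) - 2 * \<delta> e"
      using that by (simp add: second_diff_def \<delta>_def mod_add_left_eq mod_Suc_eq)
    moreover have "x (Suc e mod n) - x e = \<delta> e"
      using that by (simp add: \<delta>_def)
    ultimately show ?thesis by (simp only:) (simp add: power2_eq_square algebra_simps)
  qed
  then have expand:
    "(\<Sum>e<n. (x (Suc e mod n) - x e) * (second_diff n k x (Suc e mod n) - second_diff n k x e))
      = (\<Sum>e<n. \<delta> e * \<delta> (e + k)) + (\<Sum>e<n. \<delta> e * \<delta> (e + (n - k))) - 2 * (\<Sum>e<n. (\<delta> e)\<^sup>2)"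
    by (simp add: sum.distrib sum_subtractf sum_distrib_left)
  have mult_sum: "(\<Sum>e<n. \<delta> e * \<delta> (e + j)) = (hop n x (j + 1) + hop n x (j - 1) - 2 * hop n x j) / 2"
    if "0 < j" "j < n" for j
    using sum_mult_increments[OF that, of x] by (simp add: \<delta>_def)
  have mult_sum_reflect:
    "(\<Sum>e<n. \<delta> e * \<delta> (e + (n - k))) = (hop n x (k + 1) + hop n x (k - 1) - 2 * hop n x k) / 2"
    using mult_sum[of "n - k"] hop_reflect[of "k - 1" n x] hop_reflect[of "k + 1" n x]
      hop_reflect[of k n x] k
    by (simp add: Suc_diff_le)
  have square_sum: "(\<Sum>e<n. (\<delta> e)\<^sup>2) = hop n x 1"
    using sum_square_diff_eq_hop[of 1 n x 0] k by (simp add: \<delta>_def)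
  show ?thesis
    unfolding expand mult_sum[OF k] mult_sum_reflect square_sum by simp
qed

definition hop_step :: "nat \<Rightarrow> (nat \<Rightarrow> real) \<Rightarrow> nat \<Rightarrow> real" where
  "hop_step n d k =
     (if 0 < k \<and> k < n
      then d k + (d (k + 1) + d (k - 1) - 2 * d k - hop_noise n k * d 1) / real n else 0)"

lemma avg_hop_balance:
  assumes n: "n \<ge> 3"
  shows "(\<Sum>e<n. hop n (balance n e w x) k) / real n = hop_step n (hop n x) k + w\<^sup>2 * hop_noise n k"
proof (cases "0 < k \<and> k < n")
  case True
  then have k: "0 < k" "k < n" by auto
  have square_sum: "(\<Sum>e<n. (x (Suc e mod n) - x e)\<^sup>2) = hop n x 1"
    using n by (simp add: hop_def)
  have shifted: "(\<Sum>e<n. second_diff n k x (Suc e mod n)) = 0"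
    using sum_mod_shift[of "second_diff n k x" 1 n] by (simp add: sum_second_diff)
  have "(\<Sum>e<n. hop n (balance n e w x) k) = real n * hop n x k
      + (hop n x (k + 1) + hop n x (k - 1) - 2 * hop n x k - 2 * hop n x 1)
      + real n * (hop_noise n k * w\<^sup>2) + (2 - hop_noise n k) * hop n x 1"
    by (simp add: hop_balance[OF n k] sum.distrib sum_subtractf sum_second_diff shifted
        sum_increment_mult_second_diff[OF k] square_sum flip: sum_distrib_left)
  then show ?thesis
    using k n by (simp add: hop_step_def field_simps)
next
  case False
  then show ?thesis using n by (auto simp: hop_step_def hop_noise_def hop_def)
qed

subsection \<open>The cone of hop sums\<close>

lemma hop_step_scale: "hop_step n (\<lambda>k. a * d k) = (\<lambda>k. a * hop_step n d k)"
  by (rule ext) (simp add: hop_step_def algebra_simps add_divide_distrib diff_divide_distrib)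

lemma hop_step_add: "hop_step n (\<lambda>k. d k + d' k) = (\<lambda>k. hop_step n d k + hop_step n d' k)"
  by (rule ext) (simp add: hop_step_def algebra_simps add_divide_distrib diff_divide_distrib)

lemma hop_step_diff: "hop_step n (\<lambda>k. d k - d' k) = (\<lambda>k. hop_step n d k - hop_step n d' k)"
  by (rule ext) (simp add: hop_step_def algebra_simps add_divide_distrib diff_divide_distrib)

inductive_set hop_cone :: "nat \<Rightarrow> (nat \<Rightarrow> real) set" for n where
  scale_hop: "0 \<le> a \<Longrightarrow> (\<lambda>k. a * hop n x k) \<in> hop_cone n"
| add: "d \<in> hop_cone n \<Longrightarrow> d' \<in> hop_cone n \<Longrightarrow> (\<lambda>k. d k + d' k) \<in> hop_cone n"

lemma hop_cone_nonneg: "d \<in> hop_cone n \<Longrightarrow> 0 \<le> d k"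
  by (induction rule: hop_cone.induct) (auto simp: hop_nonneg)

lemma sum_hop_in_hop_cone:
  assumes "0 \<le> a"
  shows "(\<lambda>k. \<Sum>e\<in>E. a * hop n (x e) k) \<in> hop_cone n"
proof (induction E rule: infinite_finite_induct)
  case (insert e E)
  then show ?case using assms by (simp add: hop_cone.intros)
qed (use hop_cone.scale_hop[of 0] in simp_all)

lemma hop_step_in_hop_cone:
  assumes n: "n \<ge> 3" and "d \<in> hop_cone n"
  shows "hop_step n d \<in> hop_cone n"
  using assms(2)
proof (induction rule: hop_cone.induct)
  case (scale_hop a x)
  have "hop_step n (hop n x) k = (\<Sum>e<n. hop n (balance n e 0 x) k) / real n" for k
    using avg_hop_balance[OF n, of 0 x k] by simp
  then have "hop_step n (\<lambda>k. a * hop n x k) = (\<lambda>k. \<Sum>e<n. a / real n * hop n (balance n e 0 x) k)"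
    by (simp add: hop_step_scale sum_distrib_left sum_divide_distrib)
  then show ?case
    using scale_hop sum_hop_in_hop_cone[of "a / real n"] by simp
next
  case (add d d')
  then show ?case by (simp add: hop_step_add hop_cone.add)
qed

lemma hop_step_hop_nonneg: "n \<ge> 3 \<Longrightarrow> 0 \<le> hop_step n (hop n x) k"
  using hop_cone_nonneg[OF hop_step_in_hop_cone[OF _ hop_cone.scale_hop[of 1]]] by simp

lemma hop_sawtooth:
  assumes "k \<le> n"
  shows "hop n real k = real n * (real k * (real n - real k))"
proof (cases "k = n")
  case False
  then have k: "k < n" using assms by simp
  have "(\<Sum>i<n. (real ((i + k) mod n) - real i)\<^sup>2)
      = (\<Sum>i<n. if i < n - k then (real k)\<^sup>2 else (real n - real k)\<^sup>2)"
  proof (rule sum.cong)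
    fix i assume "i \<in> {..<n}"
    then have "(i + k) mod n = (if i < n - k then i + k else i + k - n)"
      using k by (auto simp: mod_if)
    then show "(real ((i + k) mod n) - real i)\<^sup>2
        = (if i < n - k then (real k)\<^sup>2 else (real n - real k)\<^sup>2)"
      using k by (auto simp: of_nat_diff power2_eq_square algebra_simps)
  qed simp
  also have "\<dots> = real (n - k) * (real k)\<^sup>2 + real k * (real n - real k)\<^sup>2"
  proof -
    have "{..<n} \<inter> {i. i < n - k} = {..<n - k}" "{..<n} \<inter> - {i. i < n - k} = {n - k..<n}"
      by auto
    then show ?thesis using k by (simp add: sum.If_cases)
  qed
  also have "\<dots> = real n * (real k * (real n - real k))"
    using k by (simp add: of_nat_diff power2_eq_square algebra_simps)
  finally show ?thesis using k by (simp add: hop_def)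
qed (simp add: hop_def)

definition dipole :: "nat \<Rightarrow> real" where
  "dipole = (\<lambda>_. 0)(0 := 1 / 2, 1 := - 1 / 2)"

lemma hop_dipole:
  assumes n: "n \<ge> 3" and k: "0 < k" "k < n"
  shows "hop n dipole k = 2 - hop_noise n k"
  using hop_fun_upd_adjacent[OF n k, of 0 "\<lambda>_. 0" "1 / 2" "- 1 / 2"] n k
  by (simp add: dipole_def second_diff_def hop_def power2_eq_square)

lemma hop_step_sawtooth:
  assumes n: "n \<ge> 3"
  shows "hop_step n (hop n real) k = hop n real k - real n * hop_noise n k - hop n dipole k"
proof (cases "0 < k \<and> k < n")
  case True
  then have k: "0 < k" "k < n" by auto
  have second_difference: "hop n real (k + 1) + hop n real (k - 1) - 2 * hop n real k = - 2 * real n"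
    using k by (simp add: hop_sawtooth of_nat_diff algebra_simps)
  have adjacent: "hop n real 1 = real n * (real n - 1)"
    using n by (simp add: hop_sawtooth)
  show ?thesis
    using k n unfolding hop_step_def hop_dipole[OF n k] second_difference adjacent by (simp add: field_simps)
next
  case False
  then show ?thesis by (auto simp: hop_step_def hop_noise_def hop_def)
qed

subsection \<open>Dyadic chaining\<close>

definition window_mean :: "(nat \<Rightarrow> real) \<Rightarrow> nat \<Rightarrow> nat \<Rightarrow> real" where
  "window_mean X s l = (\<Sum>i=s..<s + l. X i) / real l"

lemma window_mean_double:
  "window_mean X s (2 * l) = (window_mean X s l + window_mean X (s + l) l) / 2"
proof -
  have "(\<Sum>i=s..<s + 2 * l. X i) = (\<Sum>i=s..<s + l. X i) + (\<Sum>i=s + l..<s + l + l. X i)"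
    using sum.atLeastLessThan_concat[of s "s + l" "s + l + l" X] by (simp add: mult_2 add.assoc)
  then show ?thesis by (simp add: window_mean_def add_divide_distrib mult.commute)
qed

lemma abs_diff_window_mean_le:
  assumes "\<And>s j. j < J \<Longrightarrow> \<bar>window_mean X (s + 2 ^ j) (2 ^ j) - window_mean X s (2 ^ j)\<bar> \<le> \<delta> j"
    and "m < 2 ^ J"
  shows "\<bar>X (s + m) - window_mean X s (2 ^ J)\<bar> \<le> (\<Sum>j<J. \<delta> j) / 2"
  using assms
proof (induction J arbitrary: s m)
  case 0
  then show ?case by (simp add: window_mean_def)
next
  case (Suc J)
  define left right where "left = window_mean X s (2 ^ J)"
    and "right = window_mean X (s + 2 ^ J) (2 ^ J)"
  have mean: "window_mean X s (2 ^ Suc J) = (left + right) / 2"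
    using window_mean_double[of X s "2 ^ J"] by (simp add: left_def right_def)
  have halves: "\<bar>right - left\<bar> \<le> \<delta> J"
    using Suc.prems(1) by (simp add: left_def right_def)
  consider "m < 2 ^ J" | m' where "m = 2 ^ J + m'" "m' < 2 ^ J"
    using Suc.prems(2) le_Suc_ex[of "2 ^ J" m] by fastforce
  then show ?case
  proof cases
    case 1
    then have "\<bar>X (s + m) - left\<bar> \<le> (\<Sum>j<J. \<delta> j) / 2"
      using Suc.IH[of m s] Suc.prems(1) by (simp add: left_def)
    then show ?thesis
      unfolding mean sum.lessThan_Suc using halves by argo
  next
    case 2
    then have "\<bar>X (s + m) - right\<bar> \<le> (\<Sum>j<J. \<delta> j) / 2"
      using Suc.IH[of m' "s + 2 ^ J"] Suc.prems(1) by (simp add: right_def add.assoc)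
    then show ?thesis
      unfolding mean sum.lessThan_Suc using halves by argo
  qed
qed

lemma window_mean_diff_le_hop:
  fixes x :: "nat \<Rightarrow> real"
  assumes l: "0 < l" "l < n"
  defines "X \<equiv> \<lambda>i. x (i mod n)"
  shows "\<bar>window_mean X (s + l) l - window_mean X s l\<bar> \<le> sqrt (hop n x l / real l)"
proof (rule real_le_rsqrt)
  have shift: "(\<Sum>i=s + l..<s + l + l. X i) = (\<Sum>i=s..<s + l. X (i + l))"
    by (rule sum.shift_bounds_nat_ivl)
  have "\<bar>window_mean X (s + l) l - window_mean X s l\<bar>\<^sup>2
      = (\<Sum>i=s..<s + l. X (i + l) - X i)\<^sup>2 / (real l)\<^sup>2"
    unfolding window_mean_def shift
    by (simp add: power_divide sum_subtractf flip: diff_divide_distrib)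
  also have "\<dots> \<le> (\<Sum>i=s..<s + l. (X (i + l) - X i)\<^sup>2) * real l / (real l)\<^sup>2"
    using sum_squared_le_sum_of_squares[of "\<lambda>i. X (i + l) - X i" "{s..<s + l}"]
    by (intro divide_right_mono) auto
  also have "\<dots> = (\<Sum>i=s..<s + l. (X (i + l) - X i)\<^sup>2) / real l"
    by (simp add: power2_eq_square)
  also have "\<dots> \<le> (\<Sum>i=s..<s + n. (X (i + l) - X i)\<^sup>2) / real l"
    using l by (intro divide_right_mono sum_mono2) auto
  also have "(\<Sum>i=s..<s + n. (X (i + l) - X i)\<^sup>2) = hop n x l"
    using sum.shift_bounds_nat_ivl[of "\<lambda>i. (X (i + l) - X i)\<^sup>2" 0 s n]
      sum_square_diff_eq_hop[of l n x s] l by (simp add: X_def ac_simps lessThan_atLeast0)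
  finally show "\<bar>window_mean X (s + l) l - window_mean X s l\<bar>\<^sup>2 \<le> hop n x l / real l" .
qed

lemma Max_minus_Min_le_hop:
  assumes n: "0 < n" "n \<le> 2 ^ J" and scales: "\<And>j. j < J \<Longrightarrow> 2 ^ j < n"
  shows "Max (x ` {..<n}) - Min (x ` {..<n}) \<le> (\<Sum>j<J. sqrt (hop n x (2 ^ j) / 2 ^ j))"
proof -
  define X where "X = (\<lambda>i. x (i mod n))"
  have near: "\<bar>x a - window_mean X 0 (2 ^ J)\<bar> \<le> (\<Sum>j<J. sqrt (hop n x (2 ^ j) / 2 ^ j)) / 2"
    if "a < n" for a
  proof -
    have "\<bar>window_mean X (s + 2 ^ j) (2 ^ j) - window_mean X s (2 ^ j)\<bar>
        \<le> sqrt (hop n x (2 ^ j) / 2 ^ j)"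
      if "j < J" for s j
      using window_mean_diff_le_hop[of "2 ^ j" n x s] scales[OF that] by (simp add: X_def)
    from abs_diff_window_mean_le[OF this, of J a 0] show ?thesis
      using that n by (simp add: X_def)
  qed
  have "Max (x ` {..<n}) \<in> x ` {..<n}" "Min (x ` {..<n}) \<in> x ` {..<n}"
    using n by (auto intro!: Max_in Min_in)
  then obtain a b where "a < n" "b < n" "Max (x ` {..<n}) = x a" "Min (x ` {..<n}) = x b"
    by auto
  then show ?thesis
    using near[of a] near[of b] by linarith
qed

subsection \<open>Expected hop sums\<close>

lemma measurable_balance [measurable (raw)]:
  assumes [measurable]: "e \<in> M \<rightarrow>\<^sub>M count_space UNIV" "w \<in> borel_measurable M"
    "x \<in> borel_measurable M"
  shows "(\<lambda>\<omega>. balance n (e \<omega>) (w \<omega>) (x \<omega>)) \<in> borel_measurable M"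
proof -
  note [measurable] = measurable_product_then_coordinatewise[OF assms(3)]
  have "(\<lambda>\<omega>. balance n i (w \<omega>) (x \<omega>)) \<in> borel_measurable M" for i
    by (rule measurable_coordinatewise_then_product) (simp add: balance_def Let_def fun_upd_def)
  from measurable_compose_countable[OF this assms(1)] show ?thesis .
qed

lemma measurable_hop [measurable (raw)]:
  assumes [measurable]: "x \<in> borel_measurable M"
  shows "(\<lambda>\<omega>. hop n (x \<omega>) k) \<in> borel_measurable M"
proof -
  note [measurable] = measurable_product_then_coordinatewise[OF assms]
  show ?thesis by (cases "k < n") (simp_all add: hop_def)
qed

lemma load_cong:
  assumes "\<And>s. s < t \<Longrightarrow> \<omega> s = \<omega>' s"
  shows "load n c \<omega> t = load n c \<omega>' t"
  using assms by (induction t) simp_all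

lemma gap_nonneg:
  assumes "n > 0"
  shows "0 \<le> gap n c t \<omega>"
proof -
  let ?L = "load n c \<omega> t ` {..<n}"
  have "load n c \<omega> t 0 \<in> ?L" using assms by auto
  then have "Min ?L \<le> load n c \<omega> t 0" "load n c \<omega> t 0 \<le> Max ?L"
    by (auto intro: Min_le Max_ge)
  then show ?thesis unfolding gap_def by linarith
qed

lemma (in prob_space) expectation_sqrt_le:
  assumes X: "integrable M X" and nonneg: "\<And>\<omega>. 0 \<le> X \<omega>"
  shows "integrable M (\<lambda>\<omega>. sqrt (X \<omega>))"
    and "expectation (\<lambda>\<omega>. sqrt (X \<omega>)) \<le> sqrt (expectation X)"
proof -
  have [measurable]: "X \<in> borel_measurable M" using X by auto
  have square: "(\<lambda>\<omega>. (sqrt (X \<omega>))\<^sup>2) = X" using nonneg by auto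
  show int: "integrable M (\<lambda>\<omega>. sqrt (X \<omega>))"
    by (rule square_integrable_imp_integrable) (measurable, unfold square, rule X)
  have "variance (\<lambda>\<omega>. sqrt (X \<omega>)) = expectation X - (expectation (\<lambda>\<omega>. sqrt (X \<omega>)))\<^sup>2"
    by (rule variance_eq[OF int, unfolded square, OF X])
  then have "(expectation (\<lambda>\<omega>. sqrt (X \<omega>)))\<^sup>2 \<le> expectation X"
    using variance_positive[of "\<lambda>\<omega>. sqrt (X \<omega>)"] by linarith
  then show "expectation (\<lambda>\<omega>. sqrt (X \<omega>)) \<le> sqrt (expectation X)"
    by (rule real_le_rsqrt)
qed

lemma (in sequence_space) nn_integral_past_present:
  fixes g :: "(nat \<Rightarrow> 'a) \<Rightarrow> 'a \<Rightarrow> ennreal"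
  assumes g [measurable]: "case_prod g \<in> borel_measurable (S \<Otimes>\<^sub>M M)"
    and past: "\<And>\<omega> \<omega>'. (\<And>s. s < t \<Longrightarrow> \<omega> s = \<omega>' s) \<Longrightarrow> g \<omega> = g \<omega>'"
  shows "(\<integral>\<^sup>+\<omega>. g \<omega> (\<omega> t) \<partial>S) = (\<integral>\<^sup>+\<omega>. \<integral>\<^sup>+s. g \<omega> s \<partial>M \<partial>S)"
proof -
  have "g (comb_seq t \<omega> \<omega>') (comb_seq t \<omega> \<omega>' t) = g \<omega> (\<omega>' 0)" for \<omega> \<omega>'
    using past[of "comb_seq t \<omega> \<omega>'" \<omega>] by (simp add: comb_seq_def)
  then have "(\<integral>\<^sup>+\<omega>. g \<omega> (\<omega> t) \<partial>distr (S \<Otimes>\<^sub>M S) S (\<lambda>(\<omega>, \<omega>'). comb_seq t \<omega> \<omega>'))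
      = (\<integral>\<^sup>+z. g (fst z) (snd z 0) \<partial>(S \<Otimes>\<^sub>M S))"
    by (subst nn_integral_distr) (simp_all add: split_beta')
  also have "\<dots> = (\<integral>\<^sup>+\<omega>. \<integral>\<^sup>+\<omega>'. g \<omega> (\<omega>' 0) \<partial>S \<partial>S)"
    by (subst P.nn_integral_fst[symmetric]) simp_all
  also have "\<dots> = (\<integral>\<^sup>+\<omega>. \<integral>\<^sup>+s. g \<omega> s \<partial>M \<partial>S)"
  proof (rule nn_integral_cong)
    fix \<omega> assume [measurable]: "\<omega> \<in> space S"
    have "(\<integral>\<^sup>+s. g \<omega> s \<partial>distr S M (\<lambda>\<omega>'. \<omega>' 0)) = (\<integral>\<^sup>+\<omega>'. g \<omega> (\<omega>' 0) \<partial>S)"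
      by (subst nn_integral_distr) simp_all
    then show "(\<integral>\<^sup>+\<omega>'. g \<omega> (\<omega>' 0) \<partial>S) = (\<integral>\<^sup>+s. g \<omega> s \<partial>M)"
      by (simp add: PiM_component)
  qed
  finally show ?thesis by (simp only: PiM_comb_seq)
qed

lemma has_bochner_integral_hop_step:
  assumes "\<And>k. has_bochner_integral M (\<lambda>\<omega>. d \<omega> k) (D k)"
  shows "has_bochner_integral M (\<lambda>\<omega>. hop_step n (d \<omega>) k) (hop_step n D k)"
  unfolding hop_step_def
  by (auto intro!: has_bochner_integral_add has_bochner_integral_diff
      has_bochner_integral_divide has_bochner_integral_mult_right assms)

locale cycle_balancing = real_distribution W for W :: "real measure" +
  fixes n :: nat
  assumes n: "n \<ge> 3"
    and integrable_square_weight: "integrable W (\<lambda>w. w\<^sup>2)"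
begin

abbreviation process :: "(nat \<Rightarrow> nat \<times> real) measure" where
  "process \<equiv> cycle_process n W"

abbreviation second_moment :: real where
  "second_moment \<equiv> expectation (\<lambda>w. w\<^sup>2)"

sublocale process: prob_space process
  unfolding cycle_process_def
  by (intro prob_space_PiM prob_space_pair prob_space_measure_pmf prob_space_axioms)

lemma measurable_load [measurable]: "(\<lambda>\<omega>. load n c \<omega> t) \<in> borel_measurable process"
proof (induction t)
  case (Suc t)
  have step: "(\<lambda>\<omega>. \<omega> t) \<in> process \<rightarrow>\<^sub>M measure_pmf (pmf_of_set {..<n}) \<Otimes>\<^sub>M W"
    unfolding cycle_process_def by measurable
  have "(\<lambda>\<omega>. fst (\<omega> t)) \<in> process \<rightarrow>\<^sub>M count_space UNIV"
    using measurable_compose[OF step measurable_fst] by simp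
  moreover have "(\<lambda>\<omega>. snd (\<omega> t)) \<in> borel_measurable process"
    using measurable_compose[OF step measurable_snd]
    by (simp only: measurable_cong_sets[OF refl events_eq_borel])
  ultimately show ?case
    unfolding load.simps using Suc by (rule measurable_balance)
qed simp

lemma nn_integral_load_Suc:
  fixes f :: "(nat \<Rightarrow> real) \<Rightarrow> ennreal"
  assumes f [measurable]: "f \<in> borel_measurable borel"
  shows "(\<integral>\<^sup>+\<omega>. f (load n c \<omega> (Suc t)) \<partial>process)
    = (\<integral>\<^sup>+\<omega>. \<integral>\<^sup>+w. (\<Sum>e<n. f (balance n e w (load n c \<omega> t))) / n \<partial>W \<partial>process)"
proof -
  define p where "p = measure_pmf (pmf_of_set {..<n})"
  interpret p: prob_space p unfolding p_def by (rule prob_space_measure_pmf)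
  interpret pW: pair_prob_space p W ..
  interpret seq: sequence_space "p \<Otimes>\<^sub>M W" ..
  have process: "process = (\<Pi>\<^sub>M t\<in>UNIV. p \<Otimes>\<^sub>M W)" by (simp add: cycle_process_def p_def)
  have [measurable_cong]: "sets p = sets (count_space UNIV)" by (simp add: p_def)
  define g where "g \<omega> s = f (balance n (fst s) (snd s) (load n c \<omega> t))" for \<omega> and s :: "nat \<times> real"
  have "case_prod g \<in> borel_measurable (process \<Otimes>\<^sub>M (p \<Otimes>\<^sub>M W))"
    unfolding g_def by measurable
  moreover have "g \<omega> = g \<omega>'" if "\<And>s. s < t \<Longrightarrow> \<omega> s = \<omega>' s" for \<omega> \<omega>'
  proof -
    have "load n c \<omega> t = load n c \<omega>' t" using that by (rule load_cong)
    then show ?thesis by (intro ext) (simp add: g_def)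
  qed
  ultimately have "(\<integral>\<^sup>+\<omega>. g \<omega> (\<omega> t) \<partial>process) = (\<integral>\<^sup>+\<omega>. \<integral>\<^sup>+s. g \<omega> s \<partial>(p \<Otimes>\<^sub>M W) \<partial>process)"
    unfolding process by (rule seq.nn_integral_past_present)
  also have "\<dots> = (\<integral>\<^sup>+\<omega>. \<integral>\<^sup>+w. \<integral>\<^sup>+e. g \<omega> (e, w) \<partial>p \<partial>W \<partial>process)"
  proof (rule nn_integral_cong)
    fix \<omega>
    have "g \<omega> \<in> borel_measurable (p \<Otimes>\<^sub>M W)"
      unfolding g_def by measurable
    then show "(\<integral>\<^sup>+s. g \<omega> s \<partial>(p \<Otimes>\<^sub>M W)) = (\<integral>\<^sup>+w. \<integral>\<^sup>+e. g \<omega> (e, w) \<partial>p \<partial>W)"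
      by (subst pW.nn_integral_snd) simp_all
  qed
  also have "\<dots> = (\<integral>\<^sup>+\<omega>. \<integral>\<^sup>+w. (\<Sum>e<n. f (balance n e w (load n c \<omega> t))) / n \<partial>W \<partial>process)"
    unfolding p_def g_def using n
    by (subst nn_integral_pmf_of_set) (auto simp: ennreal_of_nat_eq_real_of_nat lessThan_empty_iff)
  finally show ?thesis by (simp add: g_def)
qed

lemma nn_integral_avg_hop_balance:
  "(\<integral>\<^sup>+w. (\<Sum>e<n. ennreal (hop n (balance n e w x) k)) / n \<partial>W)
    = ennreal (hop_step n (hop n x) k + second_moment * hop_noise n k)"
proof -
  have avg: "(\<Sum>e<n. ennreal (hop n (balance n e w x) k)) / n
      = ennreal (hop_step n (hop n x) k + w\<^sup>2 * hop_noise n k)" for w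
    unfolding avg_hop_balance[OF n, symmetric] using n
    by (simp add: sum_ennreal hop_nonneg sum_nonneg divide_ennreal ennreal_of_nat_eq_real_of_nat)
  have nonneg: "0 \<le> hop_step n (hop n x) k + w\<^sup>2 * hop_noise n k" for w
    by (simp add: hop_step_hop_nonneg[OF n] hop_noise_nonneg)
  have "(\<integral>\<^sup>+w. ennreal (hop_step n (hop n x) k + w\<^sup>2 * hop_noise n k) \<partial>W)
      = ennreal (expectation (\<lambda>w. hop_step n (hop n x) k + w\<^sup>2 * hop_noise n k))"
    using integrable_square_weight nonneg by (intro nn_integral_eq_integral) auto
  then show ?thesis
    unfolding avg using integrable_square_weight prob_space by simp
qed

lemma has_bochner_integral_hop_load_Suc:
  assumes "\<And>k. has_bochner_integral process (\<lambda>\<omega>. hop n (load n c \<omega> t) k) (D k)"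
  shows "has_bochner_integral process (\<lambda>\<omega>. hop n (load n c \<omega> (Suc t)) k)
    (hop_step n D k + second_moment * hop_noise n k)"
proof -
  define g where "g x = hop_step n (hop n x) k + second_moment * hop_noise n k" for x
  define I where "I = hop_step n D k + second_moment * hop_noise n k"
  have g: "has_bochner_integral process (\<lambda>\<omega>. g (load n c \<omega> t)) I"
    unfolding g_def I_def
    by (intro has_bochner_integral_add has_bochner_integral_hop_step assms)
      (simp add: has_bochner_integral_iff process.prob_space)
  have g_nonneg: "0 \<le> g x" for x
    unfolding g_def by (simp add: hop_step_hop_nonneg[OF n] hop_noise_nonneg)
  have "0 \<le> process.expectation (\<lambda>\<omega>. g (load n c \<omega> t))"
    by (simp add: g_nonneg)
  also have "\<dots> = I"
    by (rule has_bochner_integral_integral_eq[OF g])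
  finally have "0 \<le> I" .
  have "(\<integral>\<^sup>+\<omega>. ennreal (hop n (load n c \<omega> (Suc t)) k) \<partial>process)
      = (\<integral>\<^sup>+\<omega>. ennreal (g (load n c \<omega> t)) \<partial>process)"
    unfolding g_def by (subst nn_integral_load_Suc) (simp_all add: nn_integral_avg_hop_balance)
  also have "\<dots> = ennreal I"
    using g g_nonneg by (simp add: has_bochner_integral_iff nn_integral_eq_integral)
  finally show ?thesis
    unfolding I_def[symmetric] using \<open>0 \<le> I\<close>
    by (intro has_bochner_integral_nn_integral) (auto simp: hop_nonneg simp del: load.simps)
qed

lemma integrable_hop_load: "integrable process (\<lambda>\<omega>. hop n (load n c \<omega> t) k)"
proof (induction t arbitrary: k)
  case (Suc t)
  show ?case
    by (rule integrable.intros, rule has_bochner_integral_hop_load_Suc)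
      (rule has_bochner_integral_integrable[OF Suc])
qed (simp add: hop_def)

lemma expectation_hop_load_Suc:
  "process.expectation (\<lambda>\<omega>. hop n (load n c \<omega> (Suc t)) k)
    = hop_step n (\<lambda>k. process.expectation (\<lambda>\<omega>. hop n (load n c \<omega> t) k)) k
      + second_moment * hop_noise n k"
  by (rule has_bochner_integral_integral_eq, rule has_bochner_integral_hop_load_Suc)
    (rule has_bochner_integral_integrable[OF integrable_hop_load])

lemma sawtooth_minus_expectation_hop_load_in_hop_cone:
  "(\<lambda>k. second_moment / n * hop n real k - process.expectation (\<lambda>\<omega>. hop n (load n c \<omega> t) k))
    \<in> hop_cone n"
proof (induction t)
  case 0
  have "process.expectation (\<lambda>\<omega>. hop n (load n c \<omega> 0) k) = 0" for k
    by (simp add: hop_def)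
  then show ?case
    by (simp only: diff_zero) (intro hop_cone.scale_hop, simp)
next
  case (Suc t)
  let ?D = "\<lambda>t k. process.expectation (\<lambda>\<omega>. hop n (load n c \<omega> t) k)"
  have "second_moment / n * hop n real k - ?D (Suc t) k
      = hop_step n (\<lambda>k. second_moment / n * hop n real k - ?D t k) k
        + second_moment / n * hop n dipole k" for k
    unfolding expectation_hop_load_Suc hop_step_diff hop_step_scale hop_step_sawtooth[OF n]
    using n by (simp add: field_simps)
  moreover have "(\<lambda>k. hop_step n (\<lambda>k. second_moment / n * hop n real k - ?D t k) k
      + second_moment / n * hop n dipole k) \<in> hop_cone n"
    by (intro hop_cone.add hop_step_in_hop_cone n Suc hop_cone.scale_hop) simp
  ultimately show ?case by (simp only:)
qed

lemma expectation_hop_load_le: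
  assumes "k \<le> n"
  shows "process.expectation (\<lambda>\<omega>. hop n (load n c \<omega> t) k)
    \<le> second_moment * (real k * (real n - real k))"
  using hop_cone_nonneg[OF sawtooth_minus_expectation_hop_load_in_hop_cone, of k c t] n
  by (simp add: hop_sawtooth[OF assms])

subsection \<open>Expected gap\<close>

lemma measurable_gap [measurable]: "gap n c t \<in> borel_measurable process"
proof -
  show ?thesis
    using measurable_product_then_coordinatewise[OF measurable_load]
    unfolding gap_def[abs_def]
    by (intro borel_measurable_diff borel_measurable_Max borel_measurable_Min) auto
qed

lemma expectation_sqrt_hop_load_le:
  fixes c t
  assumes k: "0 < k" "k < n"
  defines "Y \<equiv> \<lambda>\<omega>. sqrt (hop n (load n c \<omega> t) k / real k)"
  shows "integrable process Y" and "process.expectation Y \<le> sqrt (second_moment * real n)"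
proof -
  have int: "integrable process (\<lambda>\<omega>. hop n (load n c \<omega> t) k / real k)"
    using integrable_hop_load by simp
  show "integrable process Y"
    unfolding Y_def by (rule process.expectation_sqrt_le(1)[OF int]) (simp add: hop_nonneg)
  have "process.expectation Y \<le> sqrt (process.expectation (\<lambda>\<omega>. hop n (load n c \<omega> t) k / real k))"
    unfolding Y_def by (rule process.expectation_sqrt_le(2)[OF int]) (simp add: hop_nonneg)
  also have "\<dots> = sqrt (process.expectation (\<lambda>\<omega>. hop n (load n c \<omega> t) k) / real k)"
    by simp
  also have "\<dots> \<le> sqrt (second_moment * (real k * (real n - real k)) / real k)"
    using k by (intro real_sqrt_le_mono divide_right_mono expectation_hop_load_le) auto
  also have "\<dots> \<le> sqrt (second_moment * real n)"
    using k by (simp add: mult_left_mono)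
  finally show "process.expectation Y \<le> sqrt (second_moment * real n)" .
qed

lemma expectation_gap_le:
  assumes J: "n \<le> 2 ^ J" and scales: "\<And>j. j < J \<Longrightarrow> 2 ^ j < n"
  shows "integrable process (gap n c t)"
    and "process.expectation (gap n c t) \<le> real J * sqrt (second_moment * real n)"
proof -
  define Y where "Y \<omega> j = sqrt (hop n (load n c \<omega> t) (2 ^ j) / 2 ^ j)" for \<omega> j
  have gap_le: "gap n c t \<omega> \<le> (\<Sum>j<J. Y \<omega> j)" for \<omega>
    unfolding gap_def Y_def using n J scales by (intro Max_minus_Min_le_hop) auto
  have Y_int: "integrable process (\<lambda>\<omega>. Y \<omega> j)"
    and Y_le: "process.expectation (\<lambda>\<omega>. Y \<omega> j) \<le> sqrt (second_moment * real n)"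
    if "j < J" for j
    unfolding Y_def using expectation_sqrt_hop_load_le[of "2 ^ j" c t] scales[OF that] by auto
  have sum_int: "integrable process (\<lambda>\<omega>. \<Sum>j<J. Y \<omega> j)"
    using Y_int by (intro Bochner_Integration.integrable_sum) auto
  show int: "integrable process (gap n c t)"
    by (rule Bochner_Integration.integrable_bound[OF sum_int measurable_gap])
      (use n gap_nonneg in \<open>auto intro!: AE_I2 order_trans[OF gap_le abs_ge_self]\<close>)
  have "process.expectation (gap n c t) \<le> process.expectation (\<lambda>\<omega>. \<Sum>j<J. Y \<omega> j)"
    by (intro integral_mono int sum_int gap_le)
  also have "\<dots> = (\<Sum>j<J. process.expectation (\<lambda>\<omega>. Y \<omega> j))"
    using Y_int by (intro Bochner_Integration.integral_sum) auto
  also have "\<dots> \<le> (\<Sum>j<J. sqrt (second_moment * real n))"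
    using Y_le by (intro sum_mono) auto
  finally show "process.expectation (gap n c t) \<le> real J * sqrt (second_moment * real n)"
    by simp
qed

end

lemma Suc_le_3_mult_ln:
  fixes n :: nat
  assumes n: "n \<ge> 3" and I: "2 ^ I < n"
  shows "real (Suc I) \<le> 3 * ln (real n)"
proof -
  have "1 \<le> ln (real n)"
    using ln_ge_iff[of "real n" 1] exp_le n by linarith
  moreover have "real I / 2 \<le> real I * ln 2"
    using ln_le_minus_one[of "1 / 2 :: real"] mult_left_mono[of "1 / 2" "ln 2" "real I"]
    by (simp add: ln_div)
  moreover have "real I * ln 2 \<le> ln (real n)"
  proof -
    have "ln (real (2 ^ I)) \<le> ln (real n)"
      using I n by (subst ln_le_cancel_iff) (auto simp del: of_nat_power)
    then show ?thesis by (simp add: ln_realpow)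
  qed
  ultimately show ?thesis by simp
qed

theorem theorem1:
  "\<exists>C::real. \<forall>(n::nat) (W::real measure) (c::real) (t::nat).
     n \<ge> 3 \<longrightarrow> real_distribution W \<longrightarrow>
     integrable W (\<lambda>w. w\<^sup>2) \<longrightarrow> (\<integral>w. w\<^sup>2 \<partial>W) \<le> 1 \<longrightarrow>
     integrable (cycle_process n W) (gap n c t) \<and>
     (\<integral>\<omega>. gap n c t \<omega> \<partial>cycle_process n W) \<le> C * sqrt (real n) * ln (real n)"
proof (intro exI[of _ 3] allI impI conjI)
  fix n :: nat and W :: "real measure" and c :: real and t :: nat
  assume n: "n \<ge> 3" and W: "real_distribution W" "integrable W (\<lambda>w. w\<^sup>2)"
    and second_moment_le: "(\<integral>w. w\<^sup>2 \<partial>W) \<le> 1"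
  interpret cycle_balancing W n
    using n W by (simp add: cycle_balancing_def cycle_balancing_axioms_def)
  obtain I where I: "2 ^ I < n" "n \<le> 2 ^ Suc I"
    using ex_power_ivl2[of 2 n] n by auto
  have scales: "2 ^ j < n" if "j < Suc I" for j
    using that I(1) power_increasing[of j I "2::nat"] by linarith
  show "integrable process (gap n c t)"
    by (rule expectation_gap_le(1)[OF I(2) scales])
  have "process.expectation (gap n c t) \<le> real (Suc I) * sqrt (second_moment * real n)"
    by (rule expectation_gap_le(2)[OF I(2) scales])
  also have "\<dots> \<le> 3 * ln (real n) * sqrt (1 * real n)"
    using Suc_le_3_mult_ln[OF n I(1)] second_moment_le n
    by (intro mult_mono real_sqrt_le_mono) auto
  finally show "process.expectation (gap n c t) \<le> 3 * sqrt (real n) * ln (real n)"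
    by (simp add: mult_ac)
qed

end
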